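(* Let $(f_\ell)_{\ell\in\mathbb N}$ be an admissible sequence of weight functions (as defined in the context) and let $S\subseteq\mathbb N$ with complement $E=\mathbb N\setminus S$. Assume $1,2,3\in S$ and $4\in E$. Let $n\ge 3$ be an integer with $n\equiv 2\pmod 3$. Then $\Delta_{E,\ell}(n)>0$ for all but finitely many $\ell$ (i.e. for all $\ell$ sufficiently large depending on $n$).
   Context: $\mathbb N=\{1,2,3,\dots\}$. An admissible sequence of weight functions is a sequence $(f_\ell)_{\ell\in\mathbb N}$ of functions $f_\ell:\mathbb N\to\mathbb N$ with $f_\ell(1)=1$ for all $\ell$ and $f_1\equiv 1$, for which there exist real-valued functions $\Phi,\Psi$ on $\mathbb N$ such that: (1) $n^{\Phi(\ell)}\le f_\ell(n)\le n^{\Psi(\ell)}$ for all $\ell,n\in\mathbb N$; (2) there is a positive number $B$ independent of $\ell$ with $0\le\Psi(\ell)-\Phi(\ell)\le B$ for all $\ell$; (3) $\lim_{\ell\to\infty}\Phi(\ell)=\infty$. For $S\subseteq\mathbb N$ with $1\in S$ and $E=\mathbb N\setminus S$ (the exception set), the numbers $p_{E,\ell}(n)$ are defined by the formal power series identity $\sum_{n=0}^\infty p_{E,\ell}(n)q^n=\prod_{n\in S}(1-q^n)^{-f_\ell(n)}$, and $\Delta_{E,\ell}(n):=p_{E,\ell}(n)^2-p_{E,\ell}(n-1)\,p_{E,\ell}(n+1)$ for $n\ge1$. *)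

theory Defs
  imports "HOL-Analysis.Analysis"
begin

text \<open>
  Throughout, the positive integers are the set \<open>{1..}\<close> of naturals; the value of a weight function
  at the index or argument \<open>0\<close> is irrelevant.
\<close>

definition admissible_weights :: "(nat \<Rightarrow> nat \<Rightarrow> nat) \<Rightarrow> bool" where
  "admissible_weights f \<longleftrightarrow>
     (\<forall>l\<ge>1. \<forall>n\<ge>1. f l n \<ge> 1) \<and>
     (\<forall>l\<ge>1. f l 1 = 1) \<and>
     (\<forall>n\<ge>1. f 1 n = 1) \<and>
     (\<exists>\<Phi> \<Psi> :: nat \<Rightarrow> real.
        (\<forall>l\<ge>1. \<forall>n\<ge>1. real n powr \<Phi> l \<le> real (f l n) \<and> real (f l n) \<le> real n powr \<Psi> l) \<and>
        (\<exists>B>0. \<forall>l\<ge>1. 0 \<le> \<Psi> l - \<Phi> l \<and> \<Psi> l - \<Phi> l \<le> B) \<and>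
        filterlim \<Phi> at_top sequentially)"

text \<open>
  The coefficients are integers, but the generating function is formed in \<open>real fps\<close>, where
  \<open>1 - fps_X ^ n\<close> has an inverse in the sense of the library. The infinite product is the limit of
  the partial products in the \<open>X\<close>-adic metric.
\<close>

definition euler_factor :: "(nat \<Rightarrow> nat \<Rightarrow> nat) \<Rightarrow> nat set \<Rightarrow> nat \<Rightarrow> nat \<Rightarrow> real fps" where
  "euler_factor f E l n =
     (if n \<in> {1..} - E then (1 - fps_X ^ n) powi (- int (f l n)) else 1)"

lemma euler_factor_cong_1: "fps_X ^ m dvd euler_factor f E l m - 1"
proof (cases "m \<in> {1..} - E")
  case True
  define A :: "real fps" where "A = (1 - fps_X ^ m) ^ f l m"
  have "fps_nth A 0 = 1"
    using True by (simp add: A_def fps_nth_power_0 power_0_left)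
  hence inv: "inverse A * A = 1"
    by (intro inverse_mult_eq_1) auto
  have "1 - A = (1 - (1 - fps_X ^ m)) * (\<Sum>i<f l m. (1 - fps_X ^ m) ^ i)"
    unfolding A_def by (rule one_diff_power_eq)
  hence "1 - A = fps_X ^ m * (\<Sum>i<f l m. (1 - fps_X ^ m) ^ i)"
    by simp
  hence "fps_X ^ m dvd 1 - A" by (rule dvdI)
  moreover have "euler_factor f E l m = inverse A"
  proof -
    have "inverse (1 - fps_X ^ m) ^ f l m = inverse A"
      unfolding A_def by (simp add: fps_inverse_power)
    moreover have "euler_factor f E l m = (1 - fps_X ^ m) powi (- int (f l m))"
      unfolding euler_factor_def using True by (rule if_P)
    ultimately show ?thesis
      by (simp add: power_int_def A_def)
  qed
  moreover have "inverse A - 1 = inverse A * (1 - A)"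
    using inv by (simp add: algebra_simps)
  ultimately show ?thesis by simp
next
  case False
  hence "euler_factor f E l m = 1"
    unfolding euler_factor_def by (rule if_not_P)
  thus ?thesis by simp
qed

lemma fps_nth_partial_euler_product:
  assumes "n \<le> N"
  shows "fps_nth (\<Prod>m\<le>N. euler_factor f E l m) n = fps_nth (\<Prod>m\<le>n. euler_factor f E l m) n"
  using assms
proof (induction N rule: dec_induct)
  case (step N)
  obtain G where G: "euler_factor f E l (Suc N) - 1 = fps_X ^ Suc N * G"
    using euler_factor_cong_1[of "Suc N" f E l] by (elim dvdE)
  hence G': "euler_factor f E l (Suc N) = 1 + fps_X ^ Suc N * G"
    by (simp add: algebra_simps)
  define P where "P = (\<Prod>m\<le>N. euler_factor f E l m)"
  have "(\<Prod>m\<le>Suc N. euler_factor f E l m) = P + fps_X ^ Suc N * (P * G)"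
    unfolding P_def by (simp add: G' algebra_simps del: power_Suc)
  moreover have "fps_nth (fps_X ^ Suc N * (P * G)) n = 0"
    using step.hyps by (subst fps_X_power_mult_nth) auto
  ultimately show ?case
    using step.IH by (simp add: P_def del: power_Suc)
qed simp

text \<open>The infinite product converges for all \<open>f\<close>, \<open>E\<close> and \<open>l\<close>, so \<open>p_coeff\<close> has its intended meaning.\<close>

lemma has_prod_euler_factor:
  "euler_factor f E l has_prod (\<Prod>m. euler_factor f E l m)"
proof -
  define Q where "Q = Abs_fps (\<lambda>n. fps_nth (\<Prod>m\<le>n. euler_factor f E l m) n)"
  have "(\<lambda>N. \<Prod>m\<le>N. euler_factor f E l m) \<longlonglongrightarrow> Q"
  proof (rule tendsto_fpsI)
    fix n
    show "\<forall>\<^sub>F N in sequentially. fps_nth (\<Prod>m\<le>N. euler_factor f E l m) n = fps_nth Q n"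
      using eventually_ge_at_top[of n]
      by eventually_elim (unfold Q_def fps_nth_Abs_fps, rule fps_nth_partial_euler_product)
  qed
  moreover have "euler_factor f E l 0 = 1"
    by (simp add: euler_factor_def)
  hence "fps_nth Q 0 = 1"
    by (simp add: Q_def)
  hence "Q \<noteq> 0" by auto
  ultimately have "euler_factor f E l has_prod Q"
    by (simp add: has_prod_def raw_has_prod_def)
  thus ?thesis
    using has_prod_unique[of "euler_factor f E l" Q] by simp
qed

definition p_coeff :: "(nat \<Rightarrow> nat \<Rightarrow> nat) \<Rightarrow> nat set \<Rightarrow> nat \<Rightarrow> nat \<Rightarrow> real" where
  "p_coeff f E l n = fps_nth (\<Prod>m. euler_factor f E l m) n"

definition Delta :: "(nat \<Rightarrow> nat \<Rightarrow> nat) \<Rightarrow> nat set \<Rightarrow> nat \<Rightarrow> nat \<Rightarrow> real" where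
  "Delta f E l n = (p_coeff f E l n)\<^sup>2 - p_coeff f E l (n - 1) * p_coeff f E l (n + 1)"

end

theory Submission
  imports Defs
begin

text \<open>
  Logarithmic differentiation of the Euler product gives
  \<open>n p(n) = (\<Sum>m=1..n. \<sigma>(m) p(n - m))\<close> with \<open>\<sigma>(m)\<close> the sum of \<open>d f(d)\<close> over the divisors
  \<open>d \<notin> E\<close> of \<open>m\<close>. As \<open>l\<close> grows, \<open>p(n)\<close> is dominated by the partitions of \<open>n\<close> whose parts have
  maximal product. With \<open>4\<close> excluded these are \<open>3\<^sup>k\<close>, \<open>2 3\<^sup>k\<close> and \<open>2 2 3\<^sup>k\<close> for \<open>n = 3k\<close>,
  \<open>3k + 2\<close> and \<open>3k + 4\<close>, and the recurrence yields
  \<open>p(n) \<sim> b\<^sup>k / k!\<close>, \<open>a b\<^sup>k / k!\<close> and \<open>a\<^sup>2 b\<^sup>k / (2 k!)\<close> respectively, where \<open>a = f(2)\<close> and \<open>b = f(3)\<close>.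
  For \<open>n = 3k + 2\<close> the two terms of \<open>\<Delta>(n)\<close> therefore both have order \<open>a\<^sup>2 b\<^bsup>2k\<^esup>\<close>, and the sign is
  decided by the constants: \<open>1 / k!\<^sup>2 > 1 / (2 (k - 1)! (k + 1)!)\<close>.
\<close>

section \<open>The recurrence from logarithmic differentiation\<close>

text \<open>Partial products agree up to coefficient \<open>n\<close> from index \<open>n\<close>
  on, so their \<open>X\<close>-adic limit is the series \<open>Q\<close> of these stable
  coefficients. This replaces the infinite product by a finite one, to which the ordinary product
  rule applies.\<close>

lemma p_coeff_eq_partial:
  assumes "n \<le> N"
  shows "p_coeff f E l n = fps_nth (\<Prod>m\<le>N. euler_factor f E l m) n"
proof -
  define Q where "Q = Abs_fps (\<lambda>n. fps_nth (\<Prod>m\<le>n. euler_factor f E l m) n)"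
  have "(\<lambda>N. \<Prod>m\<le>N. euler_factor f E l m) \<longlonglongrightarrow> Q"
  proof (rule tendsto_fpsI)
    fix n
    show "\<forall>\<^sub>F N in sequentially. fps_nth (\<Prod>m\<le>N. euler_factor f E l m) n = fps_nth Q n"
      using eventually_ge_at_top[of n]
      by eventually_elim (unfold Q_def fps_nth_Abs_fps, rule fps_nth_partial_euler_product)
  qed
  moreover have "(\<lambda>N. \<Prod>m\<le>N. euler_factor f E l m) \<longlonglongrightarrow> (\<Prod>m. euler_factor f E l m)"
    by (rule has_prod_imp_tendsto[OF has_prod_euler_factor])
  ultimately have "(\<Prod>m. euler_factor f E l m) = Q"
    by (intro LIMSEQ_unique)
  then show ?thesis
    by (simp add: p_coeff_def Q_def fps_nth_partial_euler_product[OF assms])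
qed

text \<open>This is the Lambert series term \<open>X^d / (1 - X^d)\<close>, given by coefficients so
  that divisor sums can be read off directly. The condition \<open>0 < n\<close> removes the
  constant term, since every \<open>d\<close> divides 0.\<close>

definition fps_multiples :: "nat \<Rightarrow> real fps" where
  "fps_multiples d = Abs_fps (\<lambda>n. if 0 < n \<and> d dvd n then 1 else 0)"

lemma fps_multiples_eq:
  assumes "d > 0"
  shows "fps_multiples d = fps_X ^ d * inverse (1 - fps_X ^ d)"
proof -
  have unit: "fps_nth (1 - fps_X ^ d :: real fps) 0 \<noteq> 0"
    using assms by (simp add: fps_X_power_nth)
  have "fps_multiples d * (1 - fps_X ^ d) = fps_X ^ d"
  proof (rule fps_ext)
    fix n
    have "fps_nth (fps_multiples d * (1 - fps_X ^ d)) n =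
        fps_nth (fps_multiples d) n - (if n < d then 0 else fps_nth (fps_multiples d) (n - d))"
      by (simp add: right_diff_distrib fps_X_power_mult_right_nth)
    also have "\<dots> = fps_nth (fps_X ^ d) n"
    proof (cases n d rule: linorder_cases)
      case less
      then show ?thesis by (auto simp: fps_multiples_def fps_X_power_nth nat_dvd_not_less)
    next
      case equal
      then show ?thesis using assms by (simp add: fps_multiples_def fps_X_power_nth)
    next
      case greater
      then show ?thesis by (simp add: fps_multiples_def fps_X_power_nth dvd_minus_self)
    qed
    finally show "fps_nth (fps_multiples d * (1 - fps_X ^ d)) n = fps_nth (fps_X ^ d) n" .
  qed
  then have "fps_multiples d * ((1 - fps_X ^ d) * inverse (1 - fps_X ^ d)) =
      fps_X ^ d * inverse (1 - fps_X ^ d)"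
    by (simp only: mult.assoc[symmetric])
  then show ?thesis
    using inverse_mult_eq_1'[OF unit] by simp
qed

text \<open>With \<open>U = 1 / (1 - X^d)\<close> one has \<open>X U' = d X^d U^2\<close>, hence
  \<open>X (U^k)' = U^k (d k X^d U)\<close>. Stating it as \<open>X e' = e h\<close>, without
  dividing by \<open>e\<close>, lets the \<open>h\<close> simply add up over a product.\<close>

lemma fps_log_deriv_euler_factor:
  "fps_X * fps_deriv (euler_factor f E l d) =
     euler_factor f E l d * (if d \<in> {1..} - E then of_nat (d * f l d) * fps_multiples d else 0)"
proof (cases "d \<in> {1..} - E")
  case True
  then have d: "d > 0" by auto
  define U :: "real fps" where "U = inverse (1 - fps_X ^ d)"
  have e: "euler_factor f E l d = U ^ f l d"
  proof -
    have "euler_factor f E l d = (1 - fps_X ^ d) powi (- int (f l d))"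
      unfolding euler_factor_def using True by (rule if_P)
    then show ?thesis
      by (simp add: U_def power_int_def)
  qed
  have unit: "fps_nth (1 - fps_X ^ d :: real fps) 0 \<noteq> 0"
    using d by (simp add: fps_X_power_nth)
  have X: "fps_X * fps_X ^ (d - 1) = (fps_X ^ d :: real fps)"
    using d by (simp add: power_eq_if)
  have "fps_deriv U = of_nat d * fps_X ^ (d - 1) * U ^ 2"
    unfolding U_def using fps_inverse_deriv[OF unit]
    by (simp add: fps_deriv_power fps_of_nat)
  then have "fps_X * fps_deriv U = of_nat d * (fps_X * fps_X ^ (d - 1)) * U ^ 2"
    by (simp add: mult_ac)
  then have dU: "fps_X * fps_deriv U = of_nat d * fps_X ^ d * U ^ 2"
    by (simp only: X)
  have "fps_X * fps_deriv (U ^ k) = U ^ k * (of_nat (d * k) * (fps_X ^ d * U))" for k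
  proof (induction k)
    case (Suc k)
    have "fps_X * fps_deriv (U ^ Suc k) = (fps_X * fps_deriv U) * U ^ k + U * (fps_X * fps_deriv (U ^ k))"
      by (simp add: algebra_simps)
    then show ?case
      by (simp only: dU Suc) (simp add: algebra_simps power2_eq_square)
  qed simp
  then show ?thesis
    using True by (simp only: e fps_multiples_eq[OF d] U_def[symmetric]) simp
next
  case False
  then have "euler_factor f E l d = 1"
    unfolding euler_factor_def by (rule if_not_P)
  then show ?thesis unfolding if_not_P[OF False] by simp
qed

definition sigma_weight :: "(nat \<Rightarrow> nat \<Rightarrow> nat) \<Rightarrow> nat set \<Rightarrow> nat \<Rightarrow> nat \<Rightarrow> real" where
  "sigma_weight f E l m = (\<Sum>d | d dvd m \<and> d \<notin> E. real (d * f l d))"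

lemma fps_log_deriv_prod:
  fixes e h :: "nat \<Rightarrow> real fps"
  assumes "\<And>d. fps_X * fps_deriv (e d) = e d * h d"
  shows "fps_X * fps_deriv (\<Prod>d\<le>N. e d) = (\<Prod>d\<le>N. e d) * (\<Sum>d\<le>N. h d)"
proof (induction N)
  case (Suc N)
  have "fps_X * fps_deriv (\<Prod>d\<le>Suc N. e d) =
      (fps_X * fps_deriv (\<Prod>d\<le>N. e d)) * e (Suc N) + (\<Prod>d\<le>N. e d) * (fps_X * fps_deriv (e (Suc N)))"
    by (simp add: algebra_simps)
  then show ?case
    by (simp only: Suc assms) (simp add: algebra_simps)
qed (simp add: assms)

lemma p_coeff_0: "p_coeff f E l 0 = 1"
  by (simp add: p_coeff_eq_partial[of 0 0] euler_factor_def)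

text \<open>Compares the coefficients of \<open>X^n\<close> on both sides of
  \<open>X P' = P H\<close>, where \<open>P\<close> is the partial Euler product and
  \<open>H\<close> the sum of its Lambert terms.\<close>

lemma p_coeff_recurrence:
  "real n * p_coeff f E l n = (\<Sum>m=1..n. sigma_weight f E l m * p_coeff f E l (n - m))"
proof -
  define P where "P = (\<Prod>d\<le>n. euler_factor f E l d)"
  define h where "h d = (if d \<in> {1..} - E then of_nat (d * f l d) * fps_multiples d else 0)" for d
  have p: "fps_nth P i = p_coeff f E l i" if "i \<le> n" for i
    using that by (simp add: P_def p_coeff_eq_partial)
  \<comment> \<open>Index 0 is split off: \<open>H\<close> has constant term 0, while the divisor
    condition in \<open>sigma_weight\<close> is vacuous at 0. For \<open>0 < m \<le> n\<close> all
    divisors of \<open>m\<close> lie in \<open>{..n}\<close>, so the truncation loses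
    nothing.\<close>
  have sigma: "fps_nth (\<Sum>d\<le>n. h d) m = (if m = 0 then 0 else sigma_weight f E l m)" if m: "m \<le> n" for m
  proof (cases "m = 0")
    case False
    have le: "d \<le> n" if "d dvd m" for d
      using dvd_imp_le[OF that] False m by simp
    have nth: "fps_nth (h d) m = (if d dvd m \<and> d \<notin> E then real (d * f l d) else 0)" for d
    proof (cases "d \<in> {1..} - E")
      case True
      then have "fps_nth (h d) m = real (d * f l d) * fps_nth (fps_multiples d) m"
        by (simp only: h_def if_True fps_mult_of_nat_nth)
      then show ?thesis using True False by (simp add: fps_multiples_def)
    next
      case notin: False
      then have "h d = 0" unfolding h_def by (rule if_not_P)
      then show ?thesis using notin False by auto
    qed
    have "fps_nth (\<Sum>d\<le>n. h d) m = (\<Sum>d\<le>n. if d dvd m \<and> d \<notin> E then real (d * f l d) else 0)"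
      by (simp only: fps_sum_nth nth)
    also have "\<dots> = (\<Sum>d\<in>{d \<in> {..n}. d dvd m \<and> d \<notin> E}. real (d * f l d))"
      by (rule sum.inter_filter[symmetric]) simp
    also have "{d \<in> {..n}. d dvd m \<and> d \<notin> E} = {d. d dvd m \<and> d \<notin> E}"
      using le by auto
    finally show ?thesis using False by (simp add: sigma_weight_def)
  qed (auto simp: fps_sum_nth h_def fps_multiples_def intro!: sum.neutral)
  have "fps_X * fps_deriv P = P * (\<Sum>d\<le>n. h d)"
    unfolding P_def by (rule fps_log_deriv_prod) (simp only: fps_log_deriv_euler_factor h_def)
  then have "fps_nth (fps_X * fps_deriv P) n = fps_nth ((\<Sum>d\<le>n. h d) * P) n"
    by (simp add: mult.commute)
  also have "fps_nth (fps_X * fps_deriv P) n = real n * p_coeff f E l n"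
    by (cases n) (simp_all add: p)
  also have "fps_nth ((\<Sum>d\<le>n. h d) * P) n = (\<Sum>m=0..n. fps_nth (\<Sum>d\<le>n. h d) m * fps_nth P (n - m))"
    by (rule fps_mult_nth)
  also have "\<dots> = (\<Sum>m=0..n. (if m = 0 then 0 else sigma_weight f E l m) * p_coeff f E l (n - m))"
    by (intro sum.cong) (simp_all add: p sigma)
  also have "\<dots> = (\<Sum>m=1..n. sigma_weight f E l m * p_coeff f E l (n - m))"
    by (simp add: sum.atLeast_Suc_atMost)
  finally show ?thesis .
qed

section \<open>Maximal products of parts and the limiting constants\<close>

text \<open>The weight of the optimal partition of \<open>n\<close>: as many parts 3 as possible,
  completed by nothing, by 2, or by 2 + 2. The value at 1 is separate because 1 leaves no room for 2
  + 2.\<close>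

definition part_scale :: "real \<Rightarrow> real \<Rightarrow> nat \<Rightarrow> real" where
  "part_scale a b n =
     (if n mod 3 = 0 then b ^ (n div 3)
      else if n mod 3 = 2 then a * b ^ (n div 3)
      else if n = 1 then 1 else a\<^sup>2 * b ^ (n div 3 - 1))"

text \<open>Choosing \<open>k\<close> parts 3 among \<open>b\<close> colours, with repetition, gives
  about \<open>b^k / k!\<close> possibilities, and choosing two parts 2 gives about
  \<open>a^2 / 2\<close>; these are the constants left after dividing by
  \<open>part_scale\<close>.\<close>

definition part_limit :: "nat \<Rightarrow> real" where
  "part_limit n =
     (if n mod 3 = 1 then if n = 1 then 1 else 1 / (2 * fact (n div 3 - 1))
      else 1 / fact (n div 3))"

lemma part_scale_simps [simp]:
  "part_scale a b (3 * k) = b ^ k"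
  "part_scale a b (3 * k + 2) = a * b ^ k"
  "part_scale a b (3 * k + 4) = a\<^sup>2 * b ^ k"
  "part_scale a b 1 = 1"
proof -
  have "(3 * k + 4) mod 3 = 1" "(3 * k + 4) div 3 = k + 1" by presburger+
  then show "part_scale a b (3 * k + 4) = a\<^sup>2 * b ^ k"
    by (simp add: part_scale_def)
  have "(3 * k + 2) mod 3 = 2" "(3 * k + 2) div 3 = k" by presburger+
  then show "part_scale a b (3 * k + 2) = a * b ^ k"
    by (simp only: part_scale_def) simp
qed (simp_all add: part_scale_def)

lemma part_scale_small [simp]:
  "part_scale a b 0 = 1" "part_scale a b (Suc 0) = 1" "part_scale a b 2 = a"
  "part_scale a b 3 = b" "part_scale a b 4 = a\<^sup>2"
  by (simp_all add: part_scale_def)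

lemma part_limit_simps [simp]:
  "part_limit (3 * k) = 1 / fact k"
  "part_limit (3 * k + 2) = 1 / fact k"
  "part_limit (3 * k + 4) = 1 / (2 * fact k)"
  "part_limit 1 = 1"
proof -
  have "(3 * k + 4) mod 3 = 1" "(3 * k + 4) div 3 = k + 1" by presburger+
  then show "part_limit (3 * k + 4) = 1 / (2 * fact k)"
    by (simp add: part_limit_def)
  have "(3 * k + 2) mod 3 = 2" "(3 * k + 2) div 3 = k" by presburger+
  then show "part_limit (3 * k + 2) = 1 / fact k"
    by (simp only: part_limit_def) simp
qed (simp_all add: part_limit_def)

text \<open>Residue 1 is written as \<open>3 * k + 4\<close> to match the completion 2 + 2 and to
  avoid truncated subtraction in exponents.\<close>

lemma residue_cases [case_names zero two four one]:
  fixes n :: nat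
  obtains k where "n = 3 * k" | k where "n = 3 * k + 2" | k where "n = 3 * k + 4" | "n = 1"
proof -
  have n: "n = 3 * (n div 3) + n mod 3" by simp
  have "n mod 3 < 3" by simp
  then consider "n mod 3 = 0" | "n mod 3 = 1" | "n mod 3 = 2" by linarith
  then show ?thesis
  proof cases
    case 1
    with n show ?thesis by (intro that(1)) simp
  next
    case 2
    show ?thesis
    proof (cases "n div 3")
      case 0
      with n 2 show ?thesis by (intro that(4)) simp
    next
      case (Suc k)
      with n 2 show ?thesis by (intro that(3)[of k]) simp
    qed
  next
    case 3
    with n show ?thesis by (intro that(2)[of "n div 3"]) simp
  qed
qed

lemma part_scale_pos: "a > 0 \<Longrightarrow> b > 0 \<Longrightarrow> part_scale a b n > 0"
  by (simp add: part_scale_def)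

lemma part_scale_mono:
  "0 \<le> a \<Longrightarrow> 0 \<le> b \<Longrightarrow> a \<le> a' \<Longrightarrow> b \<le> b' \<Longrightarrow> part_scale a b n \<le> part_scale a' b' n"
  by (auto simp: part_scale_def intro!: mult_mono power_mono)

lemma part_scale_powr:
  assumes "a > 0" "b > 0"
  shows "part_scale (a powr x) (b powr x) n = part_scale a b n powr x"
proof -
  have "(b powr x) ^ k = (b ^ k) powr x" for k
    by (induction k) (use assms in \<open>simp_all add: powr_mult\<close>)
  moreover have "(a powr x)\<^sup>2 = a\<^sup>2 powr x"
    using assms by (simp add: power2_eq_square powr_mult)
  ultimately show ?thesis
    using assms by (simp add: part_scale_def powr_mult)
qed

text \<open>Splitting a part \<open>n \<ge> 5\<close> into parts 2 and 3 strictly increases the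
  product. At 4 there is equality, \<open>4 = 2 * 2\<close>, which is why 4 must be treated as an
  exception.\<close>

lemma less_part_scale_2_3:
  assumes "n \<ge> 5"
  shows "real n < part_scale 2 3 n"
proof (cases n rule: residue_cases)
  case (zero k)
  have "3 * real k < 3 ^ k" if "k \<ge> 2"
    using that by (induction k rule: dec_induct) auto
  then show ?thesis using zero assms by simp
next
  case (two k)
  have "3 * real k + 2 < 2 * 3 ^ k" if "k \<ge> 1"
    using that by (induction k rule: dec_induct) auto
  then show ?thesis unfolding two part_scale_simps using two assms by simp
next
  case (four k)
  have "3 * real k + 4 < 2\<^sup>2 * 3 ^ k" if "k \<ge> 1"
    using that by (induction k rule: dec_induct) auto
  then show ?thesis using four assms by simp
next
  case one
  then show ?thesis using assms by simp
qed

text \<open>Joining optimal partitions of \<open>m\<close> and \<open>j\<close> gives a partition of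
  \<open>m + j\<close>, which the exchanges 2 + 2 + 2 to 3 + 3
  (\<open>a ^ 3 \<le> b\<^sup>2\<close>) and 3 + 1 to 2 + 2 (\<open>b \<le> a\<^sup>2\<close>) turn
  into the optimal one without loss. After removing the parts 3, finitely many remainders are left
  to check.\<close>

lemma part_scale_supermultiplicative:
  assumes ge: "1 \<le> a" "1 \<le> b" and ab: "a ^ 3 \<le> b\<^sup>2" "b \<le> a\<^sup>2"
  shows "part_scale a b m * part_scale a b j \<le> part_scale a b (m + j)"
proof -
  have pos: "0 < a" "0 < b" using ge by auto
  have "a * b \<le> a ^ 3"
    using mult_left_mono[OF ab(2), of a] pos by (simp add: power2_eq_square power3_eq_cube)
  then have "a * b \<le> b * b" using ab(1) by (simp add: power2_eq_square)
  then have a_le_b: "a \<le> b" using pos by simp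
  have two_four: "a * a\<^sup>2 \<le> b\<^sup>2" using ab(1) by (simp add: power2_eq_square power3_eq_cube)
  have four_four: "a\<^sup>2 * a\<^sup>2 \<le> a * b\<^sup>2"
    using mult_left_mono[OF two_four, of a] pos by (simp add: power2_eq_square mult_ac)
  have four_one: "a\<^sup>2 \<le> a * b"
    using a_le_b pos by (simp add: power2_eq_square)
  have sums: "part_scale a b 5 = a * b" "part_scale a b 6 = b\<^sup>2" "part_scale a b 8 = a * b\<^sup>2"
    by (simp_all add: part_scale_def)
  let ?g = "part_scale a b"
  have pairs: "?g 1 * ?g 1 \<le> ?g 2" "?g 1 * ?g 2 \<le> ?g 3" "?g 1 * ?g 4 \<le> ?g 5"
    "?g 2 * ?g 2 \<le> ?g 4" "?g 2 * ?g 4 \<le> ?g 6" "?g 4 * ?g 4 \<le> ?g 8"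
    using ge(1) a_le_b two_four four_four four_one by (simp_all add: sums power2_eq_square)
  have nums: "(1::nat) + 1 = 2" "(1::nat) + 2 = 3" "(2::nat) + 1 = 3" "(1::nat) + 4 = 5" "(4::nat) + 1 = 5"
    "(2::nat) + 2 = 4" "(2::nat) + 4 = 6" "(4::nat) + 2 = 6" "(4::nat) + 4 = 8" by simp_all
  have small: "?g r * ?g s \<le> ?g (r + s)"
    if "r \<in> {0, 1, 2, 4}" "s \<in> {0, 1, 2, 4}" for r s
    using that pairs
    by (elim insertE emptyE; hypsubst)
      (simp_all only: nums part_scale_small(1) add_0 add_0_right mult_1 mult_1_right order_refl mult.commute)
  have split: "\<exists>k r. n = 3 * k + r \<and> r \<in> {0, 1, 2, 4} \<and> part_scale a b n = b ^ k * part_scale a b r" for n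
  proof (cases n rule: residue_cases)
    case (zero k)
    then show ?thesis by (intro exI[of _ k] exI[of _ 0]) (simp add: part_scale_def)
  next
    case (two k)
    then show ?thesis by (intro exI[of _ k] exI[of _ 2], simp only: part_scale_simps) simp
  next
    case (four k)
    then show ?thesis by (intro exI[of _ k] exI[of _ 4], simp only: part_scale_simps) simp
  next
    case one
    then show ?thesis by (intro exI[of _ 0] exI[of _ 1]) simp
  qed
  \<comment> \<open>Adding parts 3 keeps a partition optimal, with equality, except when
    \<open>n = 1\<close>: then one pair 3 + 1 is exchanged for 2 + 2.\<close>
  have shift: "b ^ k * part_scale a b n \<le> part_scale a b (3 * k + n)" for k n
  proof (cases n rule: residue_cases)
    case (zero i)
    then have "3 * k + n = 3 * (k + i)" by simp
    then show ?thesis by (simp only: part_scale_simps zero) (simp add: power_add)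
  next
    case (two i)
    then have "3 * k + n = 3 * (k + i) + 2" by simp
    then show ?thesis by (simp only: part_scale_simps two) (simp add: power_add)
  next
    case (four i)
    then have "3 * k + n = 3 * (k + i) + 4" by simp
    then show ?thesis by (simp only: part_scale_simps four) (simp add: power_add)
  next
    case one
    show ?thesis
    proof (cases k)
      case (Suc i)
      then have "3 * k + n = 3 * i + 4" using one by simp
      then show ?thesis using Suc ab pos by (simp only: part_scale_simps one) (simp add: mult_right_mono)
    qed (simp add: one)
  qed
  obtain k r where m: "m = 3 * k + r" "r \<in> {0, 1, 2, 4}" "part_scale a b m = b ^ k * part_scale a b r"
    using split by blast
  obtain i s where j: "j = 3 * i + s" "s \<in> {0, 1, 2, 4}" "part_scale a b j = b ^ i * part_scale a b s"
    using split by blast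
  have "part_scale a b m * part_scale a b j = b ^ (k + i) * (part_scale a b r * part_scale a b s)"
    by (simp add: m(3) j(3) power_add mult_ac)
  also have "\<dots> \<le> b ^ (k + i) * part_scale a b (r + s)"
    using small[OF m(2) j(2)] pos by simp
  also have "\<dots> \<le> part_scale a b (3 * (k + i) + (r + s))"
    by (rule shift)
  also have "3 * (k + i) + (r + s) = m + j"
    by (simp add: m(1) j(1))
  finally show ?thesis .
qed

text \<open>This is the recurrence for \<open>p_coeff\<close> at leading order, where only
  \<open>m = 2\<close> and \<open>m = 3\<close> survive. The factors 0 or 1 are the limits in
  \<open>scale_ratio_two\<close> and \<open>scale_ratio_three\<close>: they vanish when the added
  part destroys optimality. The test \<open>n \<ge> 3\<close> keeps the truncated
  \<open>n - 3\<close> from contributing at \<open>n = 2\<close>.\<close>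

lemma part_limit_recurrence:
  assumes "n \<ge> 2"
  shows "real n * part_limit n =
    2 * part_limit (n - 2) * (if (n - 2) mod 3 = 1 then 0 else 1) +
    (if n \<ge> 3 then 3 * part_limit (n - 3) * (if n - 3 = 1 then 0 else 1) else 0)"
proof (cases n rule: residue_cases)
  case (zero k)
  then obtain i where i: "k = Suc i" using assms by (cases k) auto
  have nk: "real n = 3 * real (Suc i)" "fact k = real (Suc i) * (fact i :: real)" using zero i by simp_all
  have n3: "n - 3 = 3 * i" "n \<ge> 3" "n - 3 \<noteq> 1" using zero i by simp_all
  have "n - 2 = Suc (3 * i)" using zero i by simp
  then have "(n - 2) mod 3 = 1" by simp
  then have "2 * part_limit (n - 2) * (if (n - 2) mod 3 = 1 then 0 else 1) +
      (if n \<ge> 3 then 3 * part_limit (n - 3) * (if n - 3 = 1 then 0 else 1) else 0) =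
      3 * (1 / fact i)"
    using n3(2,3) by (simp only: n3(1) part_limit_simps) simp
  also have "\<dots> = real n * (1 / fact k)"
    using nk by (simp add: field_simps del: of_nat_Suc fact_Suc)
  finally show ?thesis by (simp only: zero part_limit_simps)
next
  case (two k)
  show ?thesis
  proof (cases k)
    case 0
    then show ?thesis using two by (simp add: part_limit_def)
  next
    case (Suc i)
    have nk: "real n = 3 * real (Suc i) + 2" "fact k = real (Suc i) * (fact i :: real)" using two Suc by simp_all
    have e: "n - 2 = 3 * k" "n - 3 = 3 * i + 2" using two Suc by simp_all
    have "n \<ge> 3" "n - 3 \<noteq> 1" using two Suc by simp_all
    moreover have "(n - 2) mod 3 \<noteq> 1" unfolding e by simp
    ultimately have "2 * part_limit (n - 2) * (if (n - 2) mod 3 = 1 then 0 else 1) +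
        (if n \<ge> 3 then 3 * part_limit (n - 3) * (if n - 3 = 1 then 0 else 1) else 0) =
        2 * (1 / fact k) * 1 + 3 * (1 / fact i) * 1"
      by (simp only: if_False if_True) (simp only: e part_limit_simps)
    also have "\<dots> = real n * (1 / fact k)"
      using nk by (simp add: field_simps del: of_nat_Suc fact_Suc)
    finally show ?thesis by (simp only: two part_limit_simps)
  qed
next
  case (four k)
  show ?thesis
  proof (cases k)
    case 0
    then show ?thesis using four by (simp add: part_limit_def)
  next
    case (Suc i)
    have nk: "real n = 3 * real (Suc i) + 4" "fact k = real (Suc i) * (fact i :: real)" using four Suc by simp_all
    have e: "n - 2 = 3 * k + 2" "n - 3 = 3 * i + 4" using four Suc by simp_all
    have "n \<ge> 3" "n - 3 \<noteq> 1" using four Suc by simp_all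
    moreover have "(n - 2) mod 3 \<noteq> 1" unfolding e by presburger
    ultimately have "2 * part_limit (n - 2) * (if (n - 2) mod 3 = 1 then 0 else 1) +
        (if n \<ge> 3 then 3 * part_limit (n - 3) * (if n - 3 = 1 then 0 else 1) else 0) =
        2 * (1 / fact k) * 1 + 3 * (1 / (2 * fact i)) * 1"
      by (simp only: if_False if_True) (simp only: e part_limit_simps)
    also have "\<dots> = real n * (1 / (2 * fact k))"
      using nk by (simp add: field_simps del: of_nat_Suc fact_Suc)
    finally show ?thesis by (simp only: four part_limit_simps)
  qed
next
  case one
  then show ?thesis using assms by simp
qed

section \<open>Asymptotics of solutions of the recurrence\<close>

context
  fixes a b :: "nat \<Rightarrow> real"
  assumes a_ge: "\<forall>\<^sub>F l in sequentially. 1 \<le> a l" and b_ge: "\<forall>\<^sub>F l in sequentially. 1 \<le> b l"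
    and cube_square: "(\<lambda>l. a l ^ 3 / b l ^ 2) \<longlonglongrightarrow> 0"
    and three_four: "(\<lambda>l. b l / a l ^ 2) \<longlonglongrightarrow> 0"
begin

text \<open>The two assumed limits are the strict forms of the exchanges 2 + 2 + 2 to 3 + 3 and 3 +
  1 to 2 + 2; their product is the exchange 2 + 1 to 3.\<close>

lemma a_over_b: "(\<lambda>l. a l / b l) \<longlonglongrightarrow> 0"
proof (rule Lim_transform_eventually)
  show "(\<lambda>l. (a l ^ 3 / b l ^ 2) * (b l / a l ^ 2)) \<longlonglongrightarrow> 0"
    using tendsto_mult[OF cube_square three_four] by simp
  show "\<forall>\<^sub>F l in sequentially. (a l ^ 3 / b l ^ 2) * (b l / a l ^ 2) = a l / b l"
    using a_ge b_ge by eventually_elim (simp add: field_simps power2_eq_square power3_eq_cube)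
qed

lemma inverse_a: "(\<lambda>l. 1 / a l) \<longlonglongrightarrow> 0"
proof (rule Lim_transform_eventually)
  show "(\<lambda>l. (a l / b l) * (b l / a l ^ 2)) \<longlonglongrightarrow> 0"
    using tendsto_mult[OF a_over_b three_four] by simp
  show "\<forall>\<^sub>F l in sequentially. (a l / b l) * (b l / a l ^ 2) = 1 / a l"
    using a_ge b_ge by eventually_elim (simp add: field_simps power2_eq_square)
qed

text \<open>The relative loss in joining optimal partitions of \<open>m\<close> and
  \<open>j\<close>: the limit is 1 if the union is again optimal and 0 if an exchange improves
  it.\<close>

definition scale_ratio :: "nat \<Rightarrow> nat \<Rightarrow> nat \<Rightarrow> real" where
  "scale_ratio m j l = part_scale (a l) (b l) m * part_scale (a l) (b l) j / part_scale (a l) (b l) (m + j)"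

lemma scale_ratio_eqI:
  assumes "c \<longlonglongrightarrow> x"
    and "\<And>l. 1 \<le> a l \<Longrightarrow> 1 \<le> b l \<Longrightarrow> scale_ratio m j l = c l"
  shows "scale_ratio m j \<longlonglongrightarrow> x"
proof (rule Lim_transform_eventually[OF assms(1)])
  show "\<forall>\<^sub>F l in sequentially. c l = scale_ratio m j l"
    using a_ge b_ge by eventually_elim (simp add: assms(2))
qed

text \<open>An extra part 1 can always be exchanged profitably: 3 + 1 to 2 + 2, 2 + 1 to 3, or 1 + 1
  to 2.\<close>

lemma scale_ratio_one:
  assumes "j \<ge> 1"
  shows "scale_ratio 1 j \<longlonglongrightarrow> 0"
proof (cases j rule: residue_cases)
  case (zero k)
  then obtain i where i: "k = Suc i" using assms by (cases k) auto
  have sum: "1 + j = 3 * i + 4" using zero i by simp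
  show ?thesis
    by (rule scale_ratio_eqI[OF three_four]; unfold scale_ratio_def sum; unfold zero i part_scale_simps; simp)
next
  case (two k)
  have sum: "1 + j = 3 * Suc k" using two by simp
  show ?thesis
    by (rule scale_ratio_eqI[OF a_over_b]; unfold scale_ratio_def sum; unfold two part_scale_simps; simp)
next
  case (four k)
  have sum: "1 + j = 3 * Suc k + 2" using four by simp
  show ?thesis
    by (rule scale_ratio_eqI[OF a_over_b]; unfold scale_ratio_def sum; unfold four part_scale_simps; simp add: power2_eq_square)
next
  case one
  have sum: "1 + j = 3 * 0 + 2" using one by simp
  show ?thesis
    by (rule scale_ratio_eqI[OF inverse_a]; unfold scale_ratio_def sum; unfold one part_scale_simps; simp)
qed

text \<open>A further 2 preserves optimality unless two parts 2 or a lone 1 are present; then 2 + 2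
  + 2 becomes 3 + 3, or 2 + 1 becomes 3.\<close>

lemma scale_ratio_two:
  "scale_ratio 2 j \<longlonglongrightarrow> (if j mod 3 = 1 then 0 else 1)"
proof (cases j rule: residue_cases)
  case (zero k)
  have sum: "2 + j = 3 * k + 2" and r: "j mod 3 \<noteq> 1" using zero by simp_all
  show ?thesis unfolding if_not_P[OF r]
    by (rule scale_ratio_eqI[OF tendsto_const]; unfold scale_ratio_def sum; unfold part_scale_small zero part_scale_simps; simp)
next
  case (two k)
  have sum: "2 + j = 3 * k + 4" and r: "j mod 3 \<noteq> 1" using two by presburger+
  show ?thesis unfolding if_not_P[OF r]
    by (rule scale_ratio_eqI[OF tendsto_const]; unfold scale_ratio_def sum; unfold part_scale_small two part_scale_simps; simp add: power2_eq_square)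
next
  case (four k)
  have sum: "2 + j = 3 * Suc (Suc k)" and r: "j mod 3 = 1" using four by presburger+
  show ?thesis unfolding if_P[OF r]
    by (rule scale_ratio_eqI[OF cube_square]; unfold scale_ratio_def sum; unfold part_scale_small four part_scale_simps; simp add: power2_eq_square power3_eq_cube)
next
  case one
  have sum: "2 + j = 3 * Suc 0" and r: "j mod 3 = 1" using one by simp_all
  show ?thesis unfolding if_P[OF r]
    by (rule scale_ratio_eqI[OF a_over_b]; unfold scale_ratio_def sum; unfold part_scale_small one part_scale_simps; simp)
qed

lemma scale_ratio_three:
  "scale_ratio 3 j \<longlonglongrightarrow> (if j = 1 then 0 else 1)"
proof (cases j rule: residue_cases)
  case (zero k)
  have sum: "3 + j = 3 * Suc k" and r: "j \<noteq> 1" using zero by presburger+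
  show ?thesis unfolding if_not_P[OF r]
    by (rule scale_ratio_eqI[OF tendsto_const]; unfold scale_ratio_def sum; unfold part_scale_small zero part_scale_simps; simp)
next
  case (two k)
  have sum: "3 + j = 3 * Suc k + 2" and r: "j \<noteq> 1" using two by simp_all
  show ?thesis unfolding if_not_P[OF r]
    by (rule scale_ratio_eqI[OF tendsto_const]; unfold scale_ratio_def sum; unfold part_scale_small two part_scale_simps; simp)
next
  case (four k)
  have sum: "3 + j = 3 * Suc k + 4" and r: "j \<noteq> 1" using four by simp_all
  show ?thesis unfolding if_not_P[OF r]
    by (rule scale_ratio_eqI[OF tendsto_const]; unfold scale_ratio_def sum; unfold part_scale_small four part_scale_simps; simp)
next
  case one
  have sum: "3 + j = 3 * 0 + 4" using one by simp
  show ?thesis unfolding if_P[OF one]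
    by (rule scale_ratio_eqI[OF three_four]; unfold scale_ratio_def sum; unfold part_scale_small one part_scale_simps; simp)
qed

text \<open>For \<open>m \<ge> 4\<close> the weight \<open>s m\<close> is itself of smaller order
  than the scale, so boundedness of the ratio suffices there.\<close>

lemma scale_ratio_bounded: "\<forall>\<^sub>F l in sequentially. norm (scale_ratio m j l) \<le> 1"
proof -
  have "\<forall>\<^sub>F l in sequentially. a l ^ 3 / b l ^ 2 < 1" "\<forall>\<^sub>F l in sequentially. b l / a l ^ 2 < 1"
    using order_tendstoD(2)[OF cube_square, of 1] order_tendstoD(2)[OF three_four, of 1] by auto
  with a_ge b_ge show ?thesis
  proof eventually_elim
    case (elim l)
    then have pos: "0 < a l" "0 < b l" by auto
    have "a l ^ 3 \<le> (b l)\<^sup>2" "b l \<le> (a l)\<^sup>2" using elim pos by (simp_all add: field_simps)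
    from part_scale_supermultiplicative[OF elim(1,2) this, of m j]
    show ?case using part_scale_pos[OF pos] by (simp add: scale_ratio_def abs_mult divide_le_eq_1 less_imp_le)
  qed
qed

text \<open>Strong induction on \<open>n\<close>: after division by the scale of \<open>n\<close>,
  each summand of the recurrence has a limit, and the limits add up to \<open>n\<close> times
  \<open>part_limit n\<close>.\<close>

lemma recurrence_asymptotics:
  fixes s p :: "nat \<Rightarrow> nat \<Rightarrow> real"
  assumes s1: "\<forall>\<^sub>F l in sequentially. s 1 l = 1"
    and s2: "(\<lambda>l. s 2 l / a l) \<longlonglongrightarrow> 2"
    and s3: "(\<lambda>l. s 3 l / b l) \<longlonglongrightarrow> 3"
    and s_large: "\<And>m. m \<ge> 4 \<Longrightarrow> (\<lambda>l. s m l / part_scale (a l) (b l) m) \<longlonglongrightarrow> 0"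
    and p0: "\<And>l. p 0 l = 1"
    and rec: "\<And>n l. real n * p n l = (\<Sum>m=1..n. s m l * p (n - m) l)"
  shows "(\<lambda>l. p n l / part_scale (a l) (b l) n) \<longlonglongrightarrow> part_limit n"
proof (induction n rule: less_induct)
  case (less n)
  define g where "g m l = part_scale (a l) (b l) m" for m l
  consider "n = 0" | "n = 1" | "n \<ge> 2" by linarith
  then show ?case
  proof cases
    case 1
    then show ?thesis by (simp add: p0 part_scale_def part_limit_def)
  next
    case 2
    have "p 1 l = s 1 l" for l using rec[of 1 l] by (simp add: p0)
    then have "\<forall>\<^sub>F l in sequentially. 1 = p n l / part_scale (a l) (b l) n"
      using s1 2 by (simp del: One_nat_def)
    then show ?thesis
      by (rule Lim_transform_eventually[rotated]) (simp add: 2 del: One_nat_def)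
  next
    case 3
    \<comment> \<open>\<open>t m\<close> is the limit of the normalised summand \<open>T m\<close>.
      The latter equals \<open>s m * p (n - m)\<close> over the scale of \<open>n\<close>, factored
      so that the induction hypothesis and \<open>scale_ratio\<close> apply separately.\<close>
    define t where "t m = (if m = 2 then 2 * part_limit (n - m) * (if (n - m) mod 3 = 1 then 0 else 1)
      else if m = 3 then 3 * part_limit (n - m) * (if n - m = 1 then 0 else 1) else 0)" for m
    define T where "T m = (\<lambda>l. (s m l / g m l) * (p (n - m) l / g (n - m) l) * scale_ratio m (n - m) l)" for m
    have T: "T m \<longlonglongrightarrow> t m" if m: "m \<in> {1..n}" for m
    proof -
      have IH: "(\<lambda>l. p (n - m) l / g (n - m) l) \<longlonglongrightarrow> part_limit (n - m)"
        unfolding g_def using m by (intro less) auto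
      consider "m = 1" | "m = 2" | "m = 3" | "m \<ge> 4" using m by force
      then show ?thesis
      proof cases
        case 1
        have s_lim: "(\<lambda>l. s m l / g m l) \<longlonglongrightarrow> 1"
          by (rule Lim_transform_eventually[OF tendsto_const])
            (use s1 in eventually_elim, simp add: g_def 1 del: One_nat_def)
        have "scale_ratio m (n - m) \<longlonglongrightarrow> 0"
          unfolding 1 using 3 by (intro scale_ratio_one) simp
        from tendsto_mult[OF tendsto_mult[OF s_lim IH] this] show ?thesis
          by (simp add: T_def t_def 1)
      next
        case 2
        have "(\<lambda>l. s m l / g m l) \<longlonglongrightarrow> 2"
          using s2 by (simp add: g_def 2)
        from tendsto_mult[OF tendsto_mult[OF this IH] scale_ratio_two[of "n - m"]]
        show ?thesis
          by (simp add: T_def t_def 2 del: One_nat_def)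
      next
        case 3
        have "(\<lambda>l. s m l / g m l) \<longlonglongrightarrow> 3"
          using s3 by (simp add: g_def 3)
        from tendsto_mult[OF tendsto_mult[OF this IH] scale_ratio_three[of "n - m"]]
        show ?thesis
          by (simp add: T_def t_def 3 del: One_nat_def)
      next
        case 4
        have "(\<lambda>l. (s m l / g m l) * (p (n - m) l / g (n - m) l)) \<longlonglongrightarrow> 0"
          using tendsto_mult[OF s_large[OF 4] IH] by (simp add: g_def)
        then have "Zfun (\<lambda>l. (s m l / g m l) * (p (n - m) l / g (n - m) l)) sequentially"
          by (simp add: tendsto_Zfun_iff)
        moreover have "Bfun (scale_ratio m (n - m)) sequentially"
          using scale_ratio_bounded by (rule BfunI)
        ultimately have "Zfun (T m) sequentially"
          unfolding T_def by (rule bounded_bilinear.Zfun_prod_Bfun[OF bounded_bilinear_mult])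
        then show ?thesis using 4 by (simp add: tendsto_Zfun_iff t_def)
      qed
    qed
    have "(\<lambda>l. (\<Sum>m=1..n. T m l) / real n) \<longlonglongrightarrow> (\<Sum>m=1..n. t m) / real n"
      by (intro tendsto_divide tendsto_sum T tendsto_const) (use 3 in auto)
    moreover have "\<forall>\<^sub>F l in sequentially. (\<Sum>m=1..n. T m l) / real n = p n l / g n l"
      using a_ge b_ge
    proof eventually_elim
      case (elim l)
      have pos: "g m l > 0" for m
        unfolding g_def using elim by (intro part_scale_pos) auto
      have "T m l = s m l * p (n - m) l / g n l" if "m \<in> {1..n}" for m
        using that pos[of m] pos[of "n - m"]
        by (simp add: T_def scale_ratio_def flip: g_def)
      then have "(\<Sum>m=1..n. T m l) = (\<Sum>m=1..n. s m l * p (n - m) l) / g n l"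
        by (simp add: sum_divide_distrib)
      also have "\<dots> = real n * p n l / g n l" by (simp only: rec)
      finally show ?case using 3 by simp
    qed
    moreover have "(\<Sum>m=1..n. t m) = real n * part_limit n"
    proof -
      have "(\<Sum>m=1..n. t m) = (\<Sum>m\<in>{1..n} \<inter> {2, 3}. t m)"
        by (intro sum.mono_neutral_right) (auto simp: t_def)
      also have "{1..n} \<inter> {2, 3} = (if n \<ge> 3 then {2, 3} else {2})"
        using 3 by auto
      also have "(\<Sum>m\<in>(if n \<ge> 3 then {2, 3} else {2}). t m) = real n * part_limit n"
        unfolding part_limit_recurrence[OF 3] by (simp add: t_def del: One_nat_def)
      finally show ?thesis .
    qed
    ultimately show ?thesis
      using 3 by (auto simp: g_def intro: Lim_transform_eventually)
  qed
qed

end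

section \<open>Growth estimates from admissibility\<close>

lemma base_powr_tendsto_0:
  fixes c :: real
  assumes "0 < c" "c < 1" "filterlim x at_top F"
  shows "((\<lambda>l. c powr x l) \<longlongrightarrow> 0) F"
proof -
  have "filterlim (\<lambda>l. ln c * x l) at_bot F"
    using assms by (intro filterlim_tendsto_neg_mult_at_bot[OF tendsto_const]) auto
  then have "((\<lambda>l. exp (ln c * x l)) \<longlongrightarrow> 0) F"
    by (rule filterlim_compose[OF exp_at_bot])
  then show ?thesis
    using assms by (simp add: powr_def mult.commute)
qed

text \<open>The ratio is at most \<open>C (p / q)^x\<close>, so a gap between the bases beats any
  constant. All comparisons of weights thereby reduce to numerical inequalities such as 8 <
  9.\<close>

lemma ratio_tendsto_0:
  fixes u v :: "nat \<Rightarrow> real"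
  assumes x: "filterlim x at_top sequentially" and pq: "0 < p" "p < q"
    and u: "\<forall>\<^sub>F l in sequentially. 0 \<le> u l \<and> u l \<le> C * p powr x l"
    and v: "\<forall>\<^sub>F l in sequentially. q powr x l \<le> v l"
  shows "(\<lambda>l. u l / v l) \<longlonglongrightarrow> 0"
proof (rule Lim_null_comparison)
  show "(\<lambda>l. C * (p / q) powr x l) \<longlonglongrightarrow> 0"
    using tendsto_mult[OF tendsto_const base_powr_tendsto_0[OF _ _ x, of "p / q"], of C] pq by simp
  show "\<forall>\<^sub>F l in sequentially. norm (u l / v l) \<le> C * (p / q) powr x l"
    using u v
  proof eventually_elim
    case (elim l)
    have q: "0 < q powr x l" using pq by simp
    then have "0 < v l" using elim by linarith
    then have "norm (u l / v l) = u l / v l" using elim by simp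
    also have "\<dots> \<le> (C * p powr x l) / q powr x l"
      using elim q by (intro frac_le) auto
    also have "\<dots> = C * (p / q) powr x l"
      using pq by (simp add: powr_divide)
    finally show ?case .
  qed
qed

text \<open>Replacing \<open>\<Psi>\<close> by \<open>\<Phi> + B\<close> leaves a single exponent:
  \<open>f l d\<close> is \<open>d powr \<Phi> l\<close> up to a factor that does not depend on
  \<open>l\<close>.\<close>

lemma admissible_bounds:
  assumes "admissible_weights f"
  obtains \<Phi> :: "nat \<Rightarrow> real" and B where "filterlim \<Phi> at_top sequentially" "B > 0"
    and "\<And>l d. l \<ge> 1 \<Longrightarrow> d \<ge> 1 \<Longrightarrow> real d powr \<Phi> l \<le> real (f l d)"
    and "\<And>l d. l \<ge> 1 \<Longrightarrow> d \<ge> 1 \<Longrightarrow> real (f l d) \<le> real d powr B * real d powr \<Phi> l"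
proof -
  obtain \<Phi> \<Psi> B where *: "\<forall>l\<ge>1. \<forall>n\<ge>1. real n powr \<Phi> l \<le> real (f l n) \<and> real (f l n) \<le> real n powr \<Psi> l"
    "B > 0" "\<forall>l\<ge>1. 0 \<le> \<Psi> l - \<Phi> l \<and> \<Psi> l - \<Phi> l \<le> B" "filterlim \<Phi> at_top sequentially"
    using assms unfolding admissible_weights_def by (elim conjE exE) (rule that; assumption)
  have "real (f l d) \<le> real d powr B * real d powr \<Phi> l" if "l \<ge> 1" "d \<ge> 1" for l d
  proof -
    have "\<Psi> l - \<Phi> l \<le> B" using *(3) that by simp
    then have "real d powr \<Psi> l \<le> real d powr (B + \<Phi> l)" using that by (intro powr_mono) auto
    moreover have "real (f l d) \<le> real d powr \<Psi> l" using *(1) that by simp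
    ultimately show ?thesis by (simp add: powr_add)
  qed
  with * show thesis by (intro that[of \<Phi> B]) auto
qed

text \<open>Checks the hypotheses of \<open>recurrence_asymptotics\<close> for
  \<open>sigma_weight\<close>. The gaps used are \<open>2^3 < 3^2\<close>, \<open>3 < 2^2\<close>,
  and \<open>m < part_scale 2 3 m\<close> for \<open>m \<ge> 5\<close>.\<close>

lemma p_coeff_asymptotics:
  assumes adm: "admissible_weights f"
    and E: "1 \<notin> E" "2 \<notin> E" "3 \<notin> E" "4 \<in> E"
  shows "(\<lambda>l. p_coeff f E l n / part_scale (real (f l 2)) (real (f l 3)) n) \<longlonglongrightarrow> part_limit n"
proof -
  obtain \<Phi> B where \<Phi>: "filterlim \<Phi> at_top sequentially" and B: "B > 0"
    and lower: "\<And>l d. l \<ge> 1 \<Longrightarrow> d \<ge> 1 \<Longrightarrow> real d powr \<Phi> l \<le> real (f l d)"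
    and upper: "\<And>l d. l \<ge> 1 \<Longrightarrow> d \<ge> 1 \<Longrightarrow> real (f l d) \<le> real d powr B * real d powr \<Phi> l"
    using admissible_bounds[OF adm] by blast
  have l1: "\<forall>\<^sub>F l in sequentially. l \<ge> (1::nat)" by (rule eventually_ge_at_top)
  have f_ge: "real (f l d) \<ge> 1" if "l \<ge> 1" "d \<ge> 1" for l d
    using adm that unfolding admissible_weights_def by (metis of_nat_1 of_nat_le_iff)
  define a b where "a l = real (f l 2)" and "b l = real (f l 3)" for l
  have a: "2 powr \<Phi> l \<le> a l" "a l \<le> 2 powr B * 2 powr \<Phi> l" "1 \<le> a l"
    and b: "3 powr \<Phi> l \<le> b l" "b l \<le> 3 powr B * 3 powr \<Phi> l" "1 \<le> b l" if "l \<ge> 1" for l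
    using lower[OF that, of 2] upper[OF that, of 2] lower[OF that, of 3] upper[OF that, of 3]
      f_ge[OF that, of 2] f_ge[OF that, of 3]
    by (simp_all add: a_def b_def)
  have a_ge: "\<forall>\<^sub>F l in sequentially. 1 \<le> a l" and b_ge: "\<forall>\<^sub>F l in sequentially. 1 \<le> b l"
    using l1 by (eventually_elim, simp add: a b)+
  have pow4: "(2 powr x)\<^sup>2 = 4 powr x" and pow8: "(2 powr x) ^ 3 = 8 powr x"
    and pow9: "(3 powr x)\<^sup>2 = 9 powr x" for x :: real
    using powr_mult[of 2 2 x] powr_mult[of 2 4 x] powr_mult[of 3 3 x]
    by (simp_all add: power2_eq_square power3_eq_cube)
  have cube_square: "(\<lambda>l. a l ^ 3 / (b l)\<^sup>2) \<longlonglongrightarrow> 0"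
  proof (rule ratio_tendsto_0[OF \<Phi>, of 8 9])
    show "\<forall>\<^sub>F l in sequentially. 0 \<le> a l ^ 3 \<and> a l ^ 3 \<le> (2 powr B) ^ 3 * 8 powr \<Phi> l"
      using l1
    proof eventually_elim
      case (elim l)
      have "a l ^ 3 \<le> (2 powr B * 2 powr \<Phi> l) ^ 3" using a[OF elim] by (intro power_mono) auto
      then show ?case using a(3)[OF elim] by (simp add: power_mult_distrib pow8)
    qed
    show "\<forall>\<^sub>F l in sequentially. 9 powr \<Phi> l \<le> (b l)\<^sup>2"
      using l1 by eventually_elim (simp add: b power_mono flip: pow9)
  qed auto
  have three_four: "(\<lambda>l. b l / (a l)\<^sup>2) \<longlonglongrightarrow> 0"
  proof (rule ratio_tendsto_0[OF \<Phi>, of 3 4])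
    show "\<forall>\<^sub>F l in sequentially. 0 \<le> b l \<and> b l \<le> 3 powr B * 3 powr \<Phi> l"
      using l1
    proof eventually_elim
      case (elim l)
      then show ?case using b[OF elim] by auto
    qed
    show "\<forall>\<^sub>F l in sequentially. 4 powr \<Phi> l \<le> (a l)\<^sup>2"
      using l1 by eventually_elim (simp add: a power_mono flip: pow4)
  qed auto
  note scale = a_ge b_ge cube_square three_four
  have inv_a: "(\<lambda>l. 1 / a l) \<longlonglongrightarrow> 0" by (rule inverse_a[OF scale])
  have f1: "f l 1 = 1" if "l \<ge> 1" for l
    using adm that unfolding admissible_weights_def by blast
  \<comment> \<open>Since \<open>4 \<in> E\<close>, the divisor 4 drops out of the sum for
    \<open>m = 4\<close>; its term \<open>4 f(4)\<close> could otherwise be as large as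
    \<open>a^2\<close>.\<close>
  have divisors: "{d. d dvd 1 \<and> d \<notin> E} = {1}" "{d. d dvd 2 \<and> d \<notin> E} = {1, 2}"
    "{d. d dvd 3 \<and> d \<notin> E} = {1, 3}" "{d. d dvd 4 \<and> d \<notin> E} = {1, 2}"
  proof -
    have small: "d \<in> {1, 2, 3, 4}" if "d dvd m" "0 < m" "m \<le> 4" for d m :: nat
      using dvd_imp_le[OF that(1,2)] dvd_pos_nat[OF that(2,1)] that(3) unfolding insert_iff by linarith
    have "d dvd 1 \<and> d \<notin> E \<longleftrightarrow> d \<in> {1}" "d dvd 2 \<and> d \<notin> E \<longleftrightarrow> d \<in> {1, 2}"
      "d dvd 3 \<and> d \<notin> E \<longleftrightarrow> d \<in> {1, 3}" "d dvd 4 \<and> d \<notin> E \<longleftrightarrow> d \<in> {1, 2}" for d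
      using small[of d 2] small[of d 3] small[of d 4] E
      by (cases "d \<in> {1, 2, 3, 4}"; auto)+
    then show "{d. d dvd 1 \<and> d \<notin> E} = {1}" "{d. d dvd 2 \<and> d \<notin> E} = {1, 2}"
      "{d. d dvd 3 \<and> d \<notin> E} = {1, 3}" "{d. d dvd 4 \<and> d \<notin> E} = {1, 2}"
      by (simp_all only: Collect_mem_eq)
  qed
  have sigma: "sigma_weight f E l 1 = 1" "sigma_weight f E l 2 = 1 + 2 * a l"
    "sigma_weight f E l 3 = 1 + 3 * b l" "sigma_weight f E l 4 = 1 + 2 * a l" if "l \<ge> 1" for l
    unfolding sigma_weight_def divisors using f1[OF that] by (simp_all add: a_def b_def)
  show ?thesis
    unfolding a_def[symmetric] b_def[symmetric]
  proof (rule recurrence_asymptotics[OF scale, where s = "\<lambda>m l. sigma_weight f E l m"])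
    show "\<forall>\<^sub>F l in sequentially. sigma_weight f E l 1 = 1"
      using l1 by eventually_elim (rule sigma)
    show "(\<lambda>l. sigma_weight f E l 2 / a l) \<longlonglongrightarrow> 2"
    proof (rule Lim_transform_eventually)
      show "(\<lambda>l. 1 / a l + 2) \<longlonglongrightarrow> 2"
        using tendsto_add[OF inv_a tendsto_const[of 2]] by simp
      show "\<forall>\<^sub>F l in sequentially. 1 / a l + 2 = sigma_weight f E l 2 / a l"
        using l1 a_ge by eventually_elim (simp add: sigma field_simps)
    qed
    show "(\<lambda>l. sigma_weight f E l 3 / b l) \<longlonglongrightarrow> 3"
    proof (rule Lim_transform_eventually)
      show "(\<lambda>l. (1 / a l) * (a l / b l) + 3) \<longlonglongrightarrow> 3"
        using tendsto_add[OF tendsto_mult[OF inv_a a_over_b[OF scale]] tendsto_const[of 3]] by simp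
      show "\<forall>\<^sub>F l in sequentially. (1 / a l) * (a l / b l) + 3 = sigma_weight f E l 3 / b l"
        using l1 a_ge b_ge by eventually_elim (simp add: sigma field_simps)
    qed
    show "(\<lambda>l. sigma_weight f E l m / part_scale (a l) (b l) m) \<longlonglongrightarrow> 0" if m: "m \<ge> 4" for m
    \<comment> \<open>At \<open>m = 4\<close> the bases 4 and \<open>2 * 2\<close> leave no gap, so
      the explicit value \<open>1 + 2 a\<close> is compared with \<open>a^2\<close>. For
      \<open>m \<ge> 5\<close> a crude bound on the divisor sum is enough.\<close>
    proof (cases "m = 4")
      case True
      show ?thesis
      proof (rule Lim_transform_eventually)
        show "(\<lambda>l. (1 / a l) * (1 / a l) + 2 * (1 / a l)) \<longlonglongrightarrow> 0"
          using tendsto_add[OF tendsto_mult[OF inv_a inv_a] tendsto_mult[OF tendsto_const[of 2] inv_a]]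
          by simp
        show "\<forall>\<^sub>F l in sequentially. (1 / a l) * (1 / a l) + 2 * (1 / a l) =
            sigma_weight f E l m / part_scale (a l) (b l) m"
          using l1 a_ge by eventually_elim (simp add: True sigma field_simps power2_eq_square)
      qed
    next
      case False
      then have m5: "m \<ge> 5" using m by simp
      show ?thesis
      proof (rule ratio_tendsto_0[OF \<Phi> _ less_part_scale_2_3[OF m5]])
        \<comment> \<open>Nonnegative exponents make \<open>d powr \<Phi> l\<close> increasing in
          \<open>d\<close>, so every divisor term is bounded by the one for
          \<open>m\<close>.\<close>
        have "\<forall>\<^sub>F l in sequentially. \<Phi> l \<ge> 0"
          using \<Phi> unfolding filterlim_at_top by (rule spec)
        with l1 show "\<forall>\<^sub>F l in sequentially. 0 \<le> sigma_weight f E l m \<and>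
            sigma_weight f E l m \<le> (real m * (real m * real m powr B)) * real m powr \<Phi> l"
        proof eventually_elim
          case (elim l)
          have sub: "{d. d dvd m \<and> d \<notin> E} \<subseteq> {1..m}"
          proof
            fix d
            assume "d \<in> {d. d dvd m \<and> d \<notin> E}"
            then show "d \<in> {1..m}"
              using dvd_imp_le[of d m] dvd_pos_nat[of m d] m by simp
          qed
          have "real (d * f l d) \<le> real m * (real m powr B * real m powr \<Phi> l)"
            if "d \<in> {1..m}" for d
          proof -
            have "real (f l d) \<le> real d powr B * real d powr \<Phi> l"
              using upper elim that by simp
            also have "\<dots> \<le> real m powr B * real m powr \<Phi> l"
              using that B elim by (intro mult_mono powr_mono2) auto
            finally show ?thesis
              using that by (simp add: mult_mono)
          qed
          then have "sigma_weight f E l m \<le>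
              of_nat (card {d. d dvd m \<and> d \<notin> E}) * (real m * (real m powr B * real m powr \<Phi> l))"
            unfolding sigma_weight_def using sub by (intro sum_bounded_above) blast
          also have "\<dots> \<le> real m * (real m * (real m powr B * real m powr \<Phi> l))"
            using card_mono[OF _ sub] by (intro mult_right_mono) auto
          finally show ?case by (simp add: sigma_weight_def sum_nonneg mult_ac)
        qed
        show "\<forall>\<^sub>F l in sequentially. part_scale 2 3 m powr \<Phi> l \<le> part_scale (a l) (b l) m"
          using l1
        proof eventually_elim
          case (elim l)
          have "part_scale 2 3 m powr \<Phi> l = part_scale (2 powr \<Phi> l) (3 powr \<Phi> l) m"
            by (simp add: part_scale_powr)
          also have "\<dots> \<le> part_scale (a l) (b l) m"
            using a[OF elim] b[OF elim] by (intro part_scale_mono) auto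
          finally show ?case .
        qed
      qed (use m in auto)
    qed
    show "p_coeff f E l 0 = 1" for l by (rule p_coeff_0)
    show "real n * p_coeff f E l n = (\<Sum>m=1..n. sigma_weight f E l m * p_coeff f E l (n - m))" for n l
      by (rule p_coeff_recurrence)
  qed
qed

section \<open>The sign of \<open>Delta\<close>\<close>

theorem theorem2p2:
  fixes f :: "nat \<Rightarrow> nat \<Rightarrow> nat" and S E :: "nat set" and n :: nat
  assumes "admissible_weights f"
    and "S \<subseteq> {1..}" and "E = {1..} - S"
    and "1 \<in> S" and "2 \<in> S" and "3 \<in> S" and "4 \<in> E"
    and "n \<ge> 3" and "n mod 3 = 2"
  shows "\<forall>\<^sub>F l in sequentially. Delta f E l n > 0"
proof -
  \<comment> \<open>The hypotheses force \<open>n \<ge> 5\<close>, hence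
    \<open>k = Suc i \<ge> 1\<close>; so \<open>n - 1\<close> has the form \<open>3 * i + 4\<close>
    and is never the exceptional value 1.\<close>
  obtain i where n: "n = 3 * Suc i + 2"
  proof
    show "n = 3 * Suc (n div 3 - 1) + 2" using assms(8,9) by presburger
  qed
  have before: "n - 1 = 3 * i + 4" and after: "n + 1 = 3 * Suc (Suc i)" using n by simp_all
  define g where "g m l = part_scale (real (f l 2)) (real (f l 3)) m" for m l
  have lim: "(\<lambda>l. p_coeff f E l m / g m l) \<longlonglongrightarrow> part_limit m" for m
    unfolding g_def using assms by (intro p_coeff_asymptotics) auto
  have "(\<lambda>l. (p_coeff f E l n / g n l)\<^sup>2 -
      (p_coeff f E l (n - 1) / g (n - 1) l) * (p_coeff f E l (n + 1) / g (n + 1) l)) \<longlonglongrightarrow>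
      (part_limit n)\<^sup>2 - part_limit (n - 1) * part_limit (n + 1)"
    by (intro tendsto_intros lim)
  moreover have "(part_limit n)\<^sup>2 - part_limit (n - 1) * part_limit (n + 1) > 0"
  proof -
    \<comment> \<open>With \<open>F = (k - 1)!\<close>, \<open>y = k\<close> and
      \<open>z = k + 1\<close>, the limits at \<open>n - 1\<close>, \<open>n\<close>,
      \<open>n + 1\<close> are \<open>1 / (2 F)\<close>, \<open>1 / (y F)\<close> and
      \<open>1 / (z y F)\<close>. The difference is positive because \<open>y < 2 z\<close>.\<close>
    define F y z :: real where "F = fact i" and "y = real (Suc i)" and "z = real (Suc (Suc i))"
    have pos: "F > 0" "y > 0" "z > y" by (simp_all add: F_def y_def z_def)
    have "(1 / (y * F))\<^sup>2 - 1 / (2 * F) * (1 / (z * (y * F))) = (2 * z - y) / (2 * z * y\<^sup>2 * F\<^sup>2)"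
      using pos by (simp add: field_simps power2_eq_square)
    also have "\<dots> > 0" using pos by simp
    finally show ?thesis
      unfolding before after unfolding n part_limit_simps fact_Suc
      by (simp only: F_def y_def z_def of_nat_fact of_nat_mult)
  qed
  ultimately have "\<forall>\<^sub>F l in sequentially. (p_coeff f E l n / g n l)\<^sup>2 -
      (p_coeff f E l (n - 1) / g (n - 1) l) * (p_coeff f E l (n + 1) / g (n + 1) l) > 0"
    by (rule order_tendstoD(1))
  with eventually_ge_at_top[of 1] show ?thesis
  proof eventually_elim
    case (elim l)
    have "f l 2 \<ge> 1" "f l 3 \<ge> 1"
      using assms(1) elim(1) unfolding admissible_weights_def by auto
    then have pos: "g m l > 0" for m
      unfolding g_def by (intro part_scale_pos) auto
    \<comment> \<open>Both sides are \<open>a^2 b^(2 k)\<close>, so the normalised difference is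
      exactly \<open>Delta\<close> over one positive scale and has the same sign.\<close>
    have "g (n - 1) l * g (n + 1) l = (g n l)\<^sup>2"
      unfolding g_def before after unfolding n part_scale_simps
      by (simp add: power2_eq_square)
    then have "(p_coeff f E l n / g n l)\<^sup>2 -
        (p_coeff f E l (n - 1) / g (n - 1) l) * (p_coeff f E l (n + 1) / g (n + 1) l) =
        Delta f E l n / (g n l)\<^sup>2"
      unfolding Delta_def by (simp add: power_divide diff_divide_distrib)
    then show ?case using elim(2) pos[of n] by (simp add: zero_less_divide_iff)
  qed
qed

end
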